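(* Consider the linear dynamics $\dot z=Az+Bv$ ($z\in\mathbb{R}^n$, $v\in\mathbb{R}$) subject to the constraint $(z,v)\in\mathcal V=\{(z,v):|\phi_u(z,v)|\le\bar u\}$, with the tightened set $\tilde{\mathcal V}=\{(z,v):|\tilde\phi_u(z,v)|\le\bar u-\epsilon\}$ obtained from a ReLU-network approximation $\tilde\phi_u$ of $\phi_u$ (all as in the context), and user-defined weights $Q\succ0$, $R\succ0$. Consider the following procedure: - choose a gain $K^*$ such that $A+BK^*$ is Hurwitz; - choose $M$ such that $M\succ Q+K^{*\top}RK^*$; - find $P^*$ from the Lyapunov equation $(A+BK^* )^\top P^*+P^*(A+BK^* )+M=0$; - define $\mathcal{Z}_p=\{z\in\mathbb{R}^n:\|z\|_{P^*}^2\le\varepsilon^*\}$, where $\varepsilon^*=\min_{z\in\partial\mathcal{Z}_{K^*}}z^\top P^*z$ and $\partial\mathcal{Z}_{K^*}$ is the boundary of $\mathcal{Z}_{K^*}=\{z\in\mathbb{R}^n:(z,K^*z)\in\tilde{\mathcal V}\}$. Then: (a) the control $v=K^*z$ makes the set $\mathcal{Z}_p$ positively invariant for $\dot z=Az+Bv$, and the constraint $(z,K^*z)\in\mathcal V$ is satisfied for all $z\in\mathcal{Z}_p$; (b) with $F(z)=\|z\|_{P^*}^2$ and $\ell(z,v)=\|z\|_Q^2+\|v\|_R^2$, $$\frac{\mathrm dF}{\mathrm dt}+\ell(z,K^*z)\le0\qquad\text{for all }z\in\mathcal{Z}_p,$$ where $\frac{\mathrm dF}{\mathrm dt}=\nabla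 F(z)^\top(A+BK^* )z$ is the derivative of $F$ along the closed loop $\dot z=(A+BK^* )z$.
   Context: Notation. $X\succ Y$ means that $X-Y$ is positive definite, and $\|x\|_P=\sqrt{x^\top Px}$ for $P\succ0$. Dynamics and constraint. A single-input differentially flat system $\dot x=f(x)+g(x)u$ with input constraint $|u|\le\bar u$ is transformed by a diffeomorphic change of variables $x=\phi_x(z)$ and an input transformation $u=\phi_u(z,v)$ into $\dot z=Az+Bv$, where $z=(y,\dot y,\dots,y^{(n-1)})^\top$ for the flat output $y$, and $(A,B)$ is the state-space form of the chain of integrators $y^{(n)}=v$ (so $\dot z_i=z_{i+1}$ for $i<n$ and $\dot z_n=v$). The map $\phi_u$ is assumed continuous on a compact domain of interest, and the equilibrium $z=0$, $v=0$ is assumed to correspond to the equilibrium $x=0$, $u=0$ of the original system. In the new coordinates the input constraint becomes $(z,v)\in\mathcal V=\{(z,v):|\phi_u(z,v)|\le\bar u\}$. ReLU approximation and tightened set. $\tilde\phi_u$ is a single-hidden-layer ReLU network approximating $\phi_u$: $\tilde\phi_u(z,v)=W^{[2]}\sigma\big(W^{[1]}\zeta+b^{[1]}\big)+b^{[2]}$ with $\zeta=(z^\top,v)^\top$ and $\sigma(s)=\max(s,0)$ componentwise. Its approximation error is bounded by $$\sup_{(z,v)\in\mathcal{Z}_w}|\phi_u(z,v)-\tilde\phi_u(z,v)|\le\epsilon$$ for some workspace of interest $\mathcal{Z}_w$. The tightened set is $\tilde{\mathcal V}=\{(z,v):|\tilde\phi_u(z,v)|\le\bar u-\epsilon\}$.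 It is a finite union of polytopes $\{\zeta:\Xi_i\zeta\le\xi_i\}$; consequently $\mathcal{Z}_{K^*}$ is a finite union of polytopes in $\mathbb{R}^n$, and $\partial\mathcal{Z}_{K^*}$ is a finite union of $(n-1)$-dimensional polytopes $\{z:\Theta_jz\le\theta_j\}$, $j=1,\dots,N_b$. The value $\varepsilon^*$ is computed as the optimal value of the mixed-integer quadratic program that minimizes $z^\top P^*z$ subject to $\Theta_jz\le\theta_j+m\,\delta_j$, $\delta_j\in\{0,1\}$ for $j=1,\dots,N_b$, and $\sum_{j=1}^{N_b}\delta_j=N_b-1$, where $m>0$ is a sufficiently large "big-M" constant (added to every component). Positive invariance. A set $\mathcal S$ is positively invariant for $\dot z=Az+Bv$ under $v=K^*z$ if every closed-loop solution with $z(0)\in\mathcal S$ satisfies $z(t)\in\mathcal S$ for all $t>0$.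
   Formalization: Two conditions, without which (a) can fail, are added: the origin lies in Z_{K*}, and (z,K*z) lies in the workspace Z_w for every z in Z_p, so that the error bound applies there. The boundary of Z_{K*} is also assumed nonempty so that the minimum is defined. *)

theory Defs
  imports "HOL-Analysis.Analysis"
begin

text \<open>
  The state space is \<open>real^'n\<close> with a linearly ordered finite index type, so that consecutive
  components make sense. The input space is \<open>real^1\<close>, so that the gain \<open>K\<close> is a row
  (\<open>real^'n^1\<close>), the input matrix is a column (\<open>real^1^'n\<close>) and the weight \<open>R\<close> is a
  1-by-1 matrix.
\<close>

definition posdef :: "real^'n^'n \<Rightarrow> bool" where
  "posdef P \<longleftrightarrow> transpose P = P \<and> (\<forall>x. x \<noteq> 0 \<longrightarrow> x \<bullet> (P *v x) > 0)"

definition mat_succ :: "real^'n^'n \<Rightarrow> real^'n^'n \<Rightarrow> bool" (infix "\<succ>" 50) where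
  "X \<succ> Y \<longleftrightarrow> posdef (X - Y)"

definition wnorm :: "real^'n^'n \<Rightarrow> real^'n \<Rightarrow> real" where
  "wnorm P x = sqrt (x \<bullet> (P *v x))"

definition hurwitz :: "real^'n^'n \<Rightarrow> bool" where
  "hurwitz X \<longleftrightarrow>
     (\<forall>(\<mu>::complex) (w::complex^'n).
        w \<noteq> 0 \<and> map_matrix complex_of_real X *v w = \<mu> *s w \<longrightarrow> Re \<mu> < 0)"


subsection \<open>Chain of integrators\<close>

text \<open>Row \<open>i\<close> of \<open>chain_A\<close> selects the immediate successor of \<open>i\<close> (and is zero for the largest
  index); \<open>chain_B\<close> acts on the largest index only.\<close>

definition chain_A :: "real^('n::{finite,linorder})^('n::{finite,linorder})" where
  "chain_A = (\<chi> i j. if i < j \<and> \<not> (\<exists>k. i < k \<and> k < j) then 1 else 0)"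

definition chain_B :: "real^1^('n::{finite,linorder})" where
  "chain_B = (\<chi> i j. if \<forall>k. k \<le> i then 1 else 0)"


subsection \<open>Flatness-based change of coordinates\<close>

definition C1_on :: "('a::euclidean_space \<Rightarrow> 'a) \<Rightarrow> 'a set \<Rightarrow> bool" where
  "C1_on f S \<longleftrightarrow>
     (\<exists>f' :: 'a \<Rightarrow> 'a \<Rightarrow>\<^sub>L 'a.
        (\<forall>x\<in>S. (f has_derivative blinfun_apply (f' x)) (at x)) \<and> continuous_on S f')"

definition diffeomorphism_on :: "'a::euclidean_space set \<Rightarrow> ('a \<Rightarrow> 'a) \<Rightarrow> bool" where
  "diffeomorphism_on S f \<longleftrightarrow>
     open S \<and> open (f ` S) \<and> inj_on f S \<and> C1_on f S \<and> C1_on (inv_into S f) (f ` S)"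

text \<open>On the coordinate domain \<open>S\<close>, the substitution \<open>x = \<phi>x z\<close>, \<open>u = \<phi>u (z, v)\<close> turns
  \<open>x' = f x + g x u\<close> into the chain of integrators, and the origin \<open>z = 0\<close>, \<open>v = 0\<close> corresponds
  to the equilibrium \<open>x = 0\<close>, \<open>u = 0\<close>. The flat output is the first component of \<open>z\<close>.\<close>

definition flat_transformation ::
  "(real^('n::{finite,linorder}) \<Rightarrow> real^('n::{finite,linorder})) \<Rightarrow> (real^('n::{finite,linorder}) \<Rightarrow> real^('n::{finite,linorder})) \<Rightarrow> (real^('n::{finite,linorder})) set \<Rightarrow>
   (real^('n::{finite,linorder}) \<Rightarrow> real^('n::{finite,linorder})) \<Rightarrow> ((real^('n::{finite,linorder})) \<times> (real^1) \<Rightarrow> real) \<Rightarrow> bool" where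
  "flat_transformation f g S \<phi>x \<phi>u \<longleftrightarrow>
     diffeomorphism_on S \<phi>x \<and>
     (\<forall>z\<in>S. \<forall>v.
        frechet_derivative \<phi>x (at z) (chain_A *v z + chain_B *v v)
          = f (\<phi>x z) + \<phi>u (z, v) *\<^sub>R g (\<phi>x z)) \<and>
     0 \<in> S \<and> f 0 = 0 \<and> \<phi>x 0 = 0 \<and> \<phi>u (0, 0) = 0"


subsection \<open>ReLU network\<close>

definition stack :: "(real^'n) \<times> (real^'m) \<Rightarrow> real^('n + 'm)" where
  "stack p = (\<chi> i. case i of Inl j \<Rightarrow> fst p $ j | Inr k \<Rightarrow> snd p $ k)"

definition relu :: "real^'h \<Rightarrow> real^'h" where
  "relu s = (\<chi> i. max (s $ i) 0)"

definition relu_net ::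
  "real^('n + 1)^'h \<Rightarrow> real^'h \<Rightarrow> real^'h^1 \<Rightarrow> real^1 \<Rightarrow> (real^'n) \<times> (real^1) \<Rightarrow> real" where
  "relu_net W1 b1 W2 b2 p = (W2 *v relu (W1 *v stack p + b1) + b2) $ 1"


subsection \<open>Constraint sets, terminal set, invariance\<close>

definition constraint_set :: "('a \<Rightarrow> real) \<Rightarrow> real \<Rightarrow> 'a set" where
  "constraint_set \<phi> c = {p. \<bar>\<phi> p\<bar> \<le> c}"

definition gain_set :: "((real^'n) \<times> (real^'m)) set \<Rightarrow> real^'n^'m \<Rightarrow> (real^'n) set" where
  "gain_set V K = {z. (z, K *v z) \<in> V}"

text \<open>The least element of the set of values; meaningful when the minimum exists.\<close>

definition boundary_min :: "real^'n^'n \<Rightarrow> (real^'n) set \<Rightarrow> real" where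
  "boundary_min P Z = (LEAST r. r \<in> (\<lambda>z. z \<bullet> (P *v z)) ` frontier Z)"

definition sublevel_ellipsoid :: "real^'n^'n \<Rightarrow> real \<Rightarrow> (real^'n) set" where
  "sublevel_ellipsoid P c = {z. (wnorm P z)\<^sup>2 \<le> c}"

definition positively_invariant ::
  "('a::real_normed_vector \<Rightarrow> 'a) \<Rightarrow> 'a set \<Rightarrow> bool" where
  "positively_invariant X S \<longleftrightarrow>
     (\<forall>z::real \<Rightarrow> 'a.
        (\<forall>t\<ge>0. (z has_vector_derivative X (z t)) (at t within {0..})) \<and> z 0 \<in> S
          \<longrightarrow> (\<forall>t>0. z t \<in> S))"

definition stage_cost :: "real^'n^'n \<Rightarrow> real^'m^'m \<Rightarrow> real^'n \<Rightarrow> real^'m \<Rightarrow> real" where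
  "stage_cost Q R z v = (wnorm Q z)\<^sup>2 + (wnorm R v)\<^sup>2"

end

theory Submission
  imports Defs "HOL-Computational_Algebra.Fundamental_Theorem_Algebra"
begin

text \<open>
  Write \<open>X = A + B ** K\<close>. The heart of the matter is that the solution \<open>P\<close> of the Lyapunov equation
  has a positive quadratic form; we argue algebraically, without the matrix exponential. Over the
  complex numbers, take a maximal \<open>P\<close>-orthogonal system on which \<open>P\<close> is positive and whose span \<open>W\<close> is
  \<open>X\<close>-invariant. If \<open>W\<close> is proper, some \<open>y \<notin> W\<close> is \<open>P\<close>-orthogonal to \<open>W\<close> with \<open>X y \<in> \<mu> y + W\<close>, where
  \<open>\<mu>\<close> is an eigenvalue of \<open>X\<close>. The Lyapunov equation at \<open>y\<close> reads \<open>2 Re \<mu> P(y, y) = - M(y, y) < 0\<close>,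
  so \<open>P(y, y) > 0\<close> and the system was not maximal.

  Along the closed loop the quadratic form has derivative \<open>- z \<bullet> M z \<le> - \<ell>(z, K z)\<close>, which gives the
  decrease and the invariance. A point of the sublevel set outside the closed set \<open>ZK\<close> would put a strictly
  smaller multiple of itself on the boundary of \<open>ZK\<close>, below the minimum of the quadratic form there.
\<close>

definition poly_act :: "complex^'n^'n \<Rightarrow> complex poly \<Rightarrow> complex^'n \<Rightarrow> complex^'n" where
  "poly_act X p v = (\<Sum>i\<le>degree p. coeff p i *s ((*v) X ^^ i) v)"

lemma poly_act_eq:
  assumes "degree p \<le> N"
  shows "poly_act X p v = (\<Sum>i\<le>N. coeff p i *s ((*v) X ^^ i) v)"
  unfolding poly_act_def using assms
  by (intro sum.mono_neutral_left) (auto simp: coeff_eq_0)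

lemma poly_act_linear_factor:
  "poly_act X ([:-\<mu>, 1:] * q) v = X *v poly_act X q v - \<mu> *s poly_act X q v"
proof -
  let ?w = "\<lambda>i. ((*v) X ^^ i) v"
  define N where "N = degree q"
  have eq: "[:-\<mu>, 1:] * q = pCons 0 q - smult \<mu> q"
    by (simp add: mult_pCons_left)
  have d: "degree ([:-\<mu>, 1:] * q) \<le> Suc N"
    unfolding eq N_def by (intro degree_diff_le) (auto simp: degree_pCons_le intro: le_SucI)
  have "poly_act X ([:-\<mu>, 1:] * q) v
      = (\<Sum>i\<le>Suc N. coeff (pCons 0 q) i *s ?w i) - (\<Sum>i\<le>Suc N. (\<mu> * coeff q i) *s ?w i)"
    unfolding poly_act_eq[OF d] unfolding eq
    by (simp add: vector_sub_rdistrib sum_subtractf[symmetric] algebra_simps del: sum.atMost_Suc)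
  also have "(\<Sum>i\<le>Suc N. coeff (pCons 0 q) i *s ?w i) = (\<Sum>i\<le>N. coeff q i *s ?w (Suc i))"
    by (subst sum.atMost_Suc_shift) simp
  also have "\<dots> = X *v poly_act X q v"
    unfolding poly_act_eq[OF order.refl] N_def[symmetric]
    by (simp add: vec.linear_sum[OF matrix_vector_mul_linear_gen] vector_scalar_commute)
  also have "(\<Sum>i\<le>Suc N. (\<mu> * coeff q i) *s ?w i) = \<mu> *s poly_act X q v"
    using poly_act_eq[of q "Suc N" X v]
    by (simp add: N_def vec.scale_sum_right vector_smult_assoc del: sum.atMost_Suc)
  finally show ?thesis .
qed

lemma poly_act_annihilator:
  fixes X :: "complex^'n^'n"
  obtains p where "p \<noteq> 0" "poly_act X p v = 0"
proof -
  let ?w = "\<lambda>i. ((*v) X ^^ i) v"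
  define n where "n = CARD('n)"
  show thesis
  proof (cases "inj_on ?w {..n}")
    case False
    then obtain i j where ij: "i \<noteq> j" "?w i = ?w j" by (auto simp: inj_on_def)
    let ?p = "monom 1 i - monom 1 j :: complex poly"
    have "coeff ?p i = 1" using ij by simp
    hence "?p \<noteq> 0" by force
    moreover have "degree ?p \<le> max i j"
      by (intro degree_diff_le) (auto intro: order.trans[OF degree_monom_le])
    hence "poly_act X ?p v = (\<Sum>k\<le>max i j. (if k = i then ?w k else 0) - (if k = j then ?w k else 0))"
      by (subst poly_act_eq) (auto intro!: sum.cong)
    hence "poly_act X ?p v = 0" using ij by (simp add: sum_subtractf)
    ultimately show thesis using that by blast
  next
    case True
    have "card (?w ` {..n}) = Suc n" using True by (simp add: card_image)
    hence "vec.dependent (?w ` {..n})"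
      using vec.independent_card_le_dim[of "?w ` {..n}" UNIV]
      by (auto simp: n_def card_cart_basis)
    then obtain c where c: "\<exists>x\<in>?w ` {..n}. c x \<noteq> 0" "(\<Sum>x\<in>?w ` {..n}. c x *s x) = 0"
      by (auto simp: vec.dependent_finite)
    define p where "p = (\<Sum>i\<le>n. monom (c (?w i)) i)"
    have coeff: "coeff p i = (if i \<le> n then c (?w i) else 0)" for i
      by (auto simp: p_def coeff_sum)
    have "degree p \<le> n" by (rule degree_le) (simp add: coeff)
    hence "poly_act X p v = 0"
      using c(2) by (simp add: poly_act_eq coeff sum.reindex[OF True])
    moreover obtain i where "i \<le> n" "c (?w i) \<noteq> 0" using c(1) by auto
    hence "p \<noteq> 0" using coeff[of i] by auto
    ultimately show thesis using that by blast
  qed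
qed

lemma invariant_subspace_extend:
  fixes X :: "complex^'n^'n"
  assumes W: "vec.subspace W" and inv: "\<And>w. w \<in> W \<Longrightarrow> X *v w \<in> W" and v: "v \<notin> W"
  obtains u \<mu> e where "u \<notin> W" "X *v u - \<mu> *s u \<in> W" "e \<noteq> 0" "X *v e = \<mu> *s e"
proof -
  obtain p0 where "p0 \<noteq> 0" "poly_act X p0 v \<in> W"
    using poly_act_annihilator[of X v] vec.subspace_0[OF W] by metis
  then obtain p where p: "p \<noteq> 0" "poly_act X p v \<in> W"
    and min: "\<And>q. q \<noteq> 0 \<Longrightarrow> poly_act X q v \<in> W \<Longrightarrow> degree p \<le> degree q"
    using ex_has_least_nat[of "\<lambda>p. p \<noteq> 0 \<and> poly_act X p v \<in> W" p0 degree] by blast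
  have "degree p \<noteq> 0"
  proof
    assume "degree p = 0"
    then obtain c where c: "p = [:c:]" by (metis degree_eq_zeroE)
    hence "c *s v \<in> W" using p by (simp add: poly_act_def)
    from vec.subspace_scale[OF W this, of "inverse c"] show False
      using v p c by (simp add: vector_smult_assoc)
  qed
  then obtain \<mu> where "poly p \<mu> = 0"
    using fundamental_theorem_of_algebra[of p] by (auto simp: constant_degree)
  then obtain q where q: "p = [:-\<mu>, 1:] * q" by (auto simp: poly_eq_0_iff_dvd elim: dvdE)
  have q0: "q \<noteq> 0" using p q by auto
  have "degree p = Suc (degree q)" 
    using q0 unfolding q by (subst degree_mult_eq) auto
  define u where "u = poly_act X q v"
  have u: "u \<notin> W" using min[OF q0] \<open>degree p = Suc (degree q)\<close> by (auto simp: u_def)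
  have Xu: "X *v u - \<mu> *s u \<in> W" using p q poly_act_linear_factor[of X \<mu> q v] by (simp add: u_def)
  let ?T = "\<lambda>x. X *v x - \<mu> *s x"
  have lin: "Vector_Spaces.linear (*s) (*s) ?T"
    by unfold_locales (auto simp: vec.scale_right_distrib matrix_vector_right_distrib vector_scalar_commute algebra_simps)
  have "\<exists>e. e \<noteq> 0 \<and> ?T e = 0"
  proof (rule ccontr)
    assume "\<nexists>e. e \<noteq> 0 \<and> ?T e = 0"
    hence inj: "inj ?T" using vec.linear_inj_iff_eq_0[OF lin] by blast
    have sub: "?T ` W \<subseteq> W" using inv W by (auto intro: vec.subspace_diff vec.subspace_scale)
    have "vec.dim (?T ` W) = vec.dim W"
      using inj by (intro vec.dim_image_eq[OF lin]) (auto intro: inj_on_subset)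
    hence "?T ` W = W"
      using vec.subspace_dim_equal[OF vec.linear_subspace_image[OF lin W] W sub] by simp
    hence "?T u \<in> ?T ` W" using Xu by simp
    thus False using u inj by (auto dest: injD)
  qed
  thus thesis using that u Xu by auto
qed

definition cform :: "complex^'n^'n \<Rightarrow> complex^'n \<Rightarrow> complex^'n \<Rightarrow> complex" where
  "cform C x y = (\<Sum>i\<in>UNIV. cnj (x $ i) * (C *v y) $ i)"

lemma cform_add_right: "cform C x (y + z) = cform C x y + cform C x z"
  by (simp add: cform_def matrix_vector_right_distrib algebra_simps sum.distrib)

lemma cform_diff_right: "cform C x (y - z) = cform C x y - cform C x z"
  by (simp add: cform_def matrix_vector_mult_diff_distrib algebra_simps sum_subtractf)

lemma cform_scale_right: "cform C x (c *s y) = c * cform C x y"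
  by (simp add: cform_def vector_scalar_commute sum_distrib_left algebra_simps)

lemma cform_zero_right [simp]: "cform C x 0 = 0"
  by (simp add: cform_def)

lemma cform_sum_right: "cform C x (\<Sum>b\<in>S. h b) = (\<Sum>b\<in>S. cform C x (h b))"
  by (induction S rule: infinite_finite_induct) (auto simp: cform_add_right)

lemma cform_double_sum:
  "cform C x y = (\<Sum>i\<in>UNIV. \<Sum>j\<in>UNIV. cnj (x $ i) * C $ i $ j * y $ j)"
  by (simp add: cform_def matrix_vector_mult_def sum_distrib_left mult.assoc)

lemma cform_hermitian:
  fixes P :: "real^'n^'n"
  assumes "transpose P = P"
  shows "cform (map_matrix of_real P) y x = cnj (cform (map_matrix of_real P) x y)"
proof -
  have sym: "P $ i $ j = P $ j $ i" for i j
    using arg_cong[OF assms, of "\<lambda>A. A $ i $ j"] by (simp add: transpose_def)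
  show ?thesis
    unfolding cform_double_sum
    by (subst sum.swap) (simp add: sym[of _ _] mult_ac)
qed

lemma cform_add_matrix: "cform (C + D) x y = cform C x y + cform D x y"
  by (simp add: cform_double_sum algebra_simps sum.distrib)

lemma cform_matrix_mult_right: "cform (C ** D) x y = cform C x (D *v y)"
  by (simp add: cform_def matrix_vector_mul_assoc)

lemma cform_matrix_mult_left:
  fixes X :: "real^'n^'n"
  shows "cform (map_matrix of_real (transpose X) ** D) x y = cform D (map_matrix of_real X *v x) y"
proof -
  have "cform (map_matrix of_real (transpose X) ** D) x y
      = (\<Sum>i\<in>UNIV. \<Sum>j\<in>UNIV. cnj (x $ i) * (complex_of_real (X $ j $ i) * (D *v y) $ j))"
    by (simp add: cform_matrix_mult_right, simp add: cform_def matrix_vector_mult_def transpose_def sum_distrib_left)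
  also have "\<dots> = (\<Sum>j\<in>UNIV. \<Sum>i\<in>UNIV. cnj (x $ i) * (complex_of_real (X $ j $ i) * (D *v y) $ j))"
    by (rule sum.swap)
  also have "\<dots> = cform D (map_matrix of_real X *v x) y"
    unfolding cform_def
    by (intro sum.cong) (simp_all add: matrix_vector_mult_def[of "map_matrix _ _"] sum_distrib_left mult_ac)
  finally show ?thesis .
qed

lemma cform_lyapunov:
  fixes X P M :: "real^'n^'n"
  assumes "transpose X ** P + P ** X + M = 0"
  defines "C \<equiv> map_matrix complex_of_real"
  shows "cform (C P) (C X *v x) y + cform (C P) x (C X *v y) = - cform (C M) x y"
proof -
  have "C (transpose X ** P + P ** X + M) = C (transpose X) ** C P + C P ** C X + C M"
    by (simp add: C_def vec_eq_iff matrix_matrix_mult_def)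
  moreover have "C 0 = 0" by (simp add: C_def vec_eq_iff)
  ultimately have "cform (C (transpose X) ** C P + C P ** C X + C M) x y = cform 0 x y"
    using assms(1) by simp
  moreover have "cform (C (transpose X) ** C P) x y = cform (C P) (C X *v x) y"
    unfolding C_def by (rule cform_matrix_mult_left)
  moreover have "cform 0 x y = 0" by (simp add: cform_def)
  ultimately show ?thesis
    by (simp add: cform_add_matrix cform_matrix_mult_right eq_neg_iff_add_eq_0)
qed

lemma cform_of_real:
  fixes P :: "real^'n^'n"
  shows "cform (map_matrix of_real P) (\<chi> i. of_real (z $ i)) (\<chi> i. of_real (z $ i))
    = of_real (z \<bullet> (P *v z))"
  by (simp add: cform_double_sum inner_vec_def matrix_vector_mult_def sum_distrib_left mult.assoc)

lemma Re_cform_pos: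
  fixes M :: "real^'n^'n"
  assumes "posdef M" "x \<noteq> 0"
  shows "Re (cform (map_matrix of_real M) x x) > 0"
proof -
  define a :: "real^'n" where "a = (\<chi> i. Re (x $ i))"
  define b :: "real^'n" where "b = (\<chi> i. Im (x $ i))"
  have "Re (cform (map_matrix of_real M) x x) = a \<bullet> (M *v a) + b \<bullet> (M *v b)"
    by (simp add: cform_double_sum inner_vec_def matrix_vector_mult_def sum_distrib_left
        a_def b_def sum.distrib[symmetric] algebra_simps)
  moreover have "a \<noteq> 0 \<or> b \<noteq> 0"
    using assms(2) by (auto simp: a_def b_def vec_eq_iff complex_eq_iff)
  moreover have "z \<bullet> (M *v z) \<ge> 0" "z \<noteq> 0 \<Longrightarrow> z \<bullet> (M *v z) > 0" for z
    using assms(1) by (cases "z = 0"; fastforce simp: posdef_def)+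
  ultimately show ?thesis by (metis add_nonneg_pos add_pos_nonneg)
qed

locale lyapunov_equation =
  fixes X P M :: "real^'n^'n"
  assumes eq: "transpose X ** P + P ** X + M = 0" and M: "posdef M"
begin

abbreviation "H \<equiv> cform (map_matrix complex_of_real P)"
abbreviation "Xc \<equiv> map_matrix complex_of_real X"

definition positive_system :: "(complex^'n) set \<Rightarrow> bool" where
  "positive_system B \<longleftrightarrow> finite B \<and> (\<forall>b\<in>B. Re (H b b) > 0)
     \<and> (\<forall>b\<in>B. \<forall>c\<in>B. b \<noteq> c \<longrightarrow> H b c = 0) \<and> (\<forall>b\<in>B. Xc *v b \<in> vec.span B)"

lemma positive_system_empty: "positive_system {}" by (simp add: positive_system_def)

lemma positive_system_spanE:
  assumes "positive_system B" "x \<in> vec.span B"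
  obtains h where "x = (\<Sum>b\<in>B. h b *s b)"
proof -
  have "finite B" using assms(1) by (simp add: positive_system_def)
  from assms(2)[unfolded vec.span_finite[OF this]] show thesis using that by blast
qed

lemma positive_system_coefficient:
  assumes "positive_system B" "b \<in> B"
  shows "H b (\<Sum>c\<in>B. h c *s c) = h b * H b b"
proof -
  have "H b (\<Sum>c\<in>B. h c *s c) = (\<Sum>c\<in>B. if c = b then h c * H b b else 0)"
    using assms unfolding cform_sum_right cform_scale_right positive_system_def by (intro sum.cong) auto
  thus ?thesis using assms by (simp add: positive_system_def)
qed

lemma positive_system_card:
  assumes "positive_system B" shows "card B \<le> CARD('n)"
proof -
  have "vec.independent B"
  proof
    assume "vec.dependent B"
    then obtain h b where "b \<in> B" "h b \<noteq> 0" "(\<Sum>c\<in>B. h c *s c) = 0"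
      using assms by (auto simp: vec.dependent_finite positive_system_def)
    thus False using positive_system_coefficient[of B b h] assms by (auto simp: positive_system_def)
  qed
  thus ?thesis
    using vec.independent_card_le_dim[of B UNIV] by (simp add: card_cart_basis)
qed

context
  assumes sym: "transpose P = P"
begin

lemma positive_system_positive:
  assumes "positive_system B" "x \<in> vec.span B" "x \<noteq> 0"
  shows "Re (H x x) > 0"
proof -
  obtain h where h: "x = (\<Sum>b\<in>B. h b *s b)"
    by (rule positive_system_spanE[OF assms(1,2)])
  have "H x b = cnj (h b) * cnj (H b b)" if "b \<in> B" for b
    using positive_system_coefficient[OF assms(1) that, of h] h cform_hermitian[OF sym, where y = x and x = b] by simp
  hence "H x x = (\<Sum>b\<in>B. h b * (cnj (h b) * cnj (H b b)))"
    by (subst (2) h) (simp add: cform_sum_right cform_scale_right)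
  moreover have "Re (h b * (cnj (h b) * cnj (H b b))) = (cmod (h b))\<^sup>2 * Re (H b b)" for b
    unfolding mult.assoc[symmetric] complex_norm_square[symmetric] by (subst times_complex.sel) simp
  ultimately have eq: "Re (H x x) = (\<Sum>b\<in>B. (cmod (h b))\<^sup>2 * Re (H b b))"
    by (simp only: Re_sum)
  obtain b where b: "b \<in> B" "h b \<noteq> 0"
    using assms(3) unfolding h by (metis (no_types, lifting) sum.neutral vec.scale_zero_left)
  hence "0 < (cmod (h b))\<^sup>2 * Re (H b b)" using assms(1) by (simp add: positive_system_def)
  thus ?thesis
    unfolding eq using assms(1) b(1) by (intro sum_pos2[of B b]) (auto simp: positive_system_def less_imp_le)
qed

lemma positive_system_extend:
  assumes hur: "hurwitz X" and B: "positive_system B" and ne: "vec.span B \<noteq> UNIV"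
  shows "\<exists>u. u \<notin> B \<and> positive_system (insert u B)"
proof -
  let ?W = "vec.span B"
  have W: "vec.subspace ?W" by simp
  have inv: "Xc *v w \<in> ?W" if "w \<in> ?W" for w
  proof -
    have "vec.span ((*v) Xc ` B) \<subseteq> ?W"
      using B by (intro vec.span_minimal) (auto simp: positive_system_def)
    thus ?thesis using that vec.linear_span_image[OF matrix_vector_mul_linear_gen, of Xc B] by blast
  qed
  obtain v where "v \<notin> ?W" using ne by blast
  obtain u \<mu> e
    where u: "u \<notin> ?W" "Xc *v u - \<mu> *s u \<in> ?W" and e: "e \<noteq> 0" "Xc *v e = \<mu> *s e"
    by (rule invariant_subspace_extend[OF W inv \<open>v \<notin> ?W\<close>])
  have \<mu>: "Re \<mu> < 0" using hur e unfolding hurwitz_def by blast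
  define p where "p = (\<Sum>b\<in>B. (H b u / H b b) *s b)"
  have p: "p \<in> ?W" unfolding p_def by (intro vec.span_sum vec.span_scale vec.span_base)
  define y where "y = u - p"
  have y: "y \<notin> ?W" using u(1) vec.span_add[OF _ p, of y] by (auto simp: y_def)
  have orth: "H b y = 0" if "b \<in> B" for b
    using positive_system_coefficient[OF B that, of "\<lambda>b. H b u / H b b", folded p_def] B that
    by (auto simp: y_def cform_diff_right positive_system_def)
  have orth': "H y w = 0" if w: "w \<in> ?W" for w
  proof -
    obtain h where h: "w = (\<Sum>b\<in>B. h b *s b)"
      by (rule positive_system_spanE[OF B w])
    have "H y b = 0" if "b \<in> B" for b
      using orth[OF that] by (simp add: cform_hermitian[OF sym, where y = y])
    thus ?thesis by (simp add: h cform_sum_right cform_scale_right)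
  qed
  define w where "w = Xc *v y - \<mu> *s y"
  have "w = (Xc *v u - \<mu> *s u) - (Xc *v p - \<mu> *s p)"
    by (simp add: w_def y_def matrix_vector_mult_diff_distrib vec.scale_right_diff_distrib)
  hence w: "w \<in> ?W" using u(2) inv p by (auto intro!: vec.span_diff vec.span_scale)
  have Xy: "Xc *v y = \<mu> *s y + w" by (simp add: w_def)
  have HyX: "H y (Xc *v y) = \<mu> * H y y"
    using orth'[OF w] by (simp add: Xy cform_add_right cform_scale_right)
  have "y \<noteq> 0" using y vec.span_zero by auto
  have "Im (H y y) = 0"
    using arg_cong[OF cform_hermitian[OF sym, where y = y and x = y], of Im] by simp
  have "Re (H (Xc *v y) y + H y (Xc *v y)) < 0"
    using Re_cform_pos[OF M \<open>y \<noteq> 0\<close>] unfolding cform_lyapunov[OF eq] by simp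
  hence "Re \<mu> * Re (H y y) < 0"
    using \<open>Im (H y y) = 0\<close> by (simp add: cform_hermitian[OF sym, where y = "Xc *v y" and x = y] HyX)
  hence "Re (H y y) > 0" using \<mu> by (simp add: mult_less_0_iff)
  moreover have "Xc *v b \<in> vec.span (insert y B)" if "b \<in> insert y B" for b
  proof -
    have sub: "?W \<subseteq> vec.span (insert y B)" by (intro vec.span_mono) auto
    have "\<mu> *s y + w \<in> vec.span (insert y B)"
      using w sub by (intro vec.span_add vec.span_scale vec.span_base[of y]) auto
    thus ?thesis using that B sub unfolding positive_system_def Xy[symmetric] by blast
  qed
  ultimately have "positive_system (insert y B)"
    using B orth orth' by (auto simp: positive_system_def vec.span_base)
  moreover have "y \<notin> B" using y by (auto intro: vec.span_base)
  ultimately show ?thesis by blast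
qed

lemma posdef_solution:
  assumes "hurwitz X"
  shows "posdef P"
proof -
  obtain B where B: "positive_system B" and max: "\<And>B'. positive_system B' \<Longrightarrow> card B' \<le> card B"
    using ex_has_greatest_nat[of positive_system "{}" card "Suc CARD('n)"] positive_system_empty positive_system_card le_imp_less_Suc
    by blast
  have "vec.span B = UNIV"
  proof (rule ccontr)
    assume "vec.span B \<noteq> UNIV"
    then obtain u where "u \<notin> B" "positive_system (insert u B)" using positive_system_extend[OF assms B] by blast
    thus False using max[of "insert u B"] B by (simp add: positive_system_def)
  qed
  hence "0 < z \<bullet> (P *v z)" if "z \<noteq> 0" for z
    using positive_system_positive[OF B, of "\<chi> i. of_real (z $ i)"] that
    by (simp add: cform_of_real vec_eq_iff)
  thus ?thesis using sym by (simp add: posdef_def)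
qed

end

end

lemma quadratic_form_lower_bound:
  fixes P :: "real^'n^'n"
  assumes pos: "\<And>x. x \<noteq> 0 \<Longrightarrow> x \<bullet> (P *v x) > 0"
  obtains c where "c > 0" "\<And>x. c * (norm x)\<^sup>2 \<le> x \<bullet> (P *v x)"
proof -
  have "continuous_on (sphere 0 1) (\<lambda>x. x \<bullet> (P *v x))"
    by (intro continuous_intros)
  moreover obtain x0 :: "real^'n" where "norm x0 = 1" using vector_choose_size[of 1] by auto
  hence "sphere 0 1 \<noteq> ({} :: (real^'n) set)" by force
  ultimately obtain s where s: "s \<in> sphere 0 1"
    and min: "\<And>x. x \<in> sphere 0 1 \<Longrightarrow> s \<bullet> (P *v s) \<le> x \<bullet> (P *v x)"
    using continuous_attains_inf[of "sphere 0 1" "\<lambda>x. x \<bullet> (P *v x)"] compact_sphere by blast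
  have "s \<bullet> (P *v s) * (norm x)\<^sup>2 \<le> x \<bullet> (P *v x)" for x
  proof (cases "x = 0")
    case False
    define y where "y = x /\<^sub>R norm x"
    have "x = norm x *\<^sub>R y" using False by (simp add: y_def)
    hence "x \<bullet> (P *v x) = (norm x)\<^sup>2 * (y \<bullet> (P *v y))"
      by (metis inner_scaleR_left inner_scaleR_right matrix_vector_mult_scaleR mult.assoc power2_eq_square)
    moreover have "y \<in> sphere 0 1" using False by (simp add: y_def)
    ultimately show ?thesis using min[of y] by (auto simp: mult.commute[of "(norm x)\<^sup>2"] intro: mult_right_mono)
  qed simp
  moreover have "s \<bullet> (P *v s) > 0" using s by (intro pos) auto
  ultimately show thesis using that by blast
qed

lemma quadratic_form_attains_inf:
  fixes P :: "real^'n^'n"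
  assumes pos: "\<And>x. x \<noteq> 0 \<Longrightarrow> x \<bullet> (P *v x) > 0" and S: "closed S" "S \<noteq> {}"
  obtains p where "p \<in> S" "\<And>z. z \<in> S \<Longrightarrow> p \<bullet> (P *v p) \<le> z \<bullet> (P *v z)"
proof -
  obtain c where c: "c > 0" "\<And>x. c * (norm x)\<^sup>2 \<le> x \<bullet> (P *v x)"
    using quadratic_form_lower_bound[OF pos] by metis
  obtain s where s: "s \<in> S" using S by blast
  let ?V = "\<lambda>x. x \<bullet> (P *v x)"
  let ?T = "S \<inter> {x. ?V x \<le> ?V s}"
  have "norm x \<le> sqrt (?V s / c)" if "x \<in> ?T" for x
    using c(2)[of x] that c(1) by (intro real_le_rsqrt) (auto simp: field_simps)
  hence "bounded ?T" by (auto intro: boundedI)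
  moreover have "closed ?T"
    using S by (intro closed_Int closed_Collect_le continuous_intros)
  ultimately have "compact ?T" by (simp add: compact_eq_bounded_closed)
  moreover have "continuous_on ?T ?V" by (intro continuous_intros)
  ultimately obtain p where "p \<in> ?T" "\<And>x. x \<in> ?T \<Longrightarrow> ?V p \<le> ?V x"
    using continuous_attains_inf[of ?T ?V] s by blast
  thus thesis using that[of p] by force
qed

lemma boundary_min_le:
  fixes P :: "real^'n^'n"
  assumes pos: "\<And>x. x \<noteq> 0 \<Longrightarrow> x \<bullet> (P *v x) > 0" and z: "z \<in> frontier Z"
  shows "boundary_min P Z \<le> z \<bullet> (P *v z)"
proof -
  obtain p where p: "p \<in> frontier Z" "\<And>z. z \<in> frontier Z \<Longrightarrow> p \<bullet> (P *v p) \<le> z \<bullet> (P *v z)"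
    using quadratic_form_attains_inf[OF pos frontier_closed[of Z]] z by blast
  have "boundary_min P Z = p \<bullet> (P *v p)"
    unfolding boundary_min_def using p by (intro Least_equality) auto
  thus ?thesis using p z by simp
qed

lemma sublevel_boundary_min_subset:
  fixes P :: "real^'n^'n"
  assumes pos: "\<And>x. x \<noteq> 0 \<Longrightarrow> x \<bullet> (P *v x) > 0"
    and Z: "closed Z" "0 \<in> Z" and z: "z \<bullet> (P *v z) \<le> boundary_min P Z"
  shows "z \<in> Z"
proof (rule ccontr)
  assume "z \<notin> Z"
  hence "z \<noteq> 0" using Z by auto
  have "closed_segment 0 z \<inter> frontier Z \<noteq> {}"
    using \<open>z \<notin> Z\<close> Z(2) by (intro connected_Int_frontier) auto
  then obtain s where s: "0 \<le> s" "s \<le> 1" "s *\<^sub>R z \<in> frontier Z"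
    by (auto simp: closed_segment_def)
  have "s *\<^sub>R z \<in> Z" using s(3) Z(1) frontier_subset_eq by blast
  hence "s < 1" using s \<open>z \<notin> Z\<close> by (cases "s = 1") auto
  hence "s * s < 1" using s(1) mult_left_mono[of s 1 s] by linarith
  have "z \<bullet> (P *v z) \<le> (s * s) * (z \<bullet> (P *v z))"
    using boundary_min_le[OF pos s(3)] z by (simp add: matrix_vector_mult_scaleR mult.assoc)
  thus False using \<open>s * s < 1\<close> pos[OF \<open>z \<noteq> 0\<close>] by (simp add: mult_le_cancel_right2)
qed

lemma continuous_on_stack [continuous_intros]:
  fixes f :: "'a::topological_space \<Rightarrow> (real^'n) \<times> (real^'m)"
  assumes "continuous_on S f"
  shows "continuous_on S (\<lambda>x. stack (f x))"
  unfolding stack_def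
proof (rule continuous_on_vec_lambda)
  fix i :: "'n + 'm"
  show "continuous_on S (\<lambda>x. case i of Inl j \<Rightarrow> fst (f x) $ j | Inr k \<Rightarrow> snd (f x) $ k)"
    using assms by (cases i) (auto intro!: continuous_intros)
qed

lemma continuous_on_relu [continuous_intros]:
  "continuous_on S f \<Longrightarrow> continuous_on S (\<lambda>x. relu (f x))"
  unfolding relu_def by (intro continuous_on_vec_lambda continuous_intros)

lemma continuous_on_relu_net [continuous_intros]:
  "continuous_on S f \<Longrightarrow> continuous_on S (\<lambda>x. relu_net W1 b1 W2 b2 (f x))"
  unfolding relu_net_def
  by (intro continuous_intros bounded_linear.continuous_on[OF matrix_vector_mul_bounded_linear])

lemma closed_gain_set_relu_net:
  "closed (gain_set (constraint_set (relu_net W1 b1 W2 b2) c) K)"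
  unfolding gain_set_def constraint_set_def mem_Collect_eq
  by (intro closed_Collect_le continuous_intros)

lemma matrix_add_rdistrib: "(A + B) ** C = A ** C + B ** (C :: real^'n^'m)"
  by (simp add: matrix_matrix_mult_def vec_eq_iff distrib_right sum.distrib)

lemma transpose_add: "transpose (A + B) = transpose A + transpose (B :: 'a::semiring_1^'n^'m)"
  by (simp add: transpose_def vec_eq_iff)

lemma inner_transpose_matrix:
  fixes A :: "real^'n^'m"
  shows "x \<bullet> (transpose A *v y) = (A *v x) \<bullet> y"
  by (metis dot_lmul_matrix inner_commute transpose_matrix_vector)

lemma lyapunov_quadratic_form_pos:
  fixes X P M :: "real^'n^'n"
  assumes eq: "transpose X ** P + P ** X + M = 0" and M: "posdef M" and X: "hurwitz X"
    and "x \<noteq> 0"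
  shows "x \<bullet> (P *v x) > 0"
proof -
  \<comment> \<open>Symmetrizing \<open>P\<close> preserves the equation and avoids proving its solution unique.\<close>
  let ?S = "P + transpose P"
  have "transpose (transpose X ** P + P ** X + M) = 0"
    unfolding eq by (simp add: transpose_def vec_eq_iff)
  hence "transpose P ** X + transpose X ** transpose P + M = 0"
    using M by (simp add: transpose_add matrix_transpose_mul posdef_def)
  hence "(transpose X ** P + P ** X + M) + (transpose P ** X + transpose X ** transpose P + M) = 0"
    using eq by simp
  hence "transpose X ** ?S + ?S ** X + (M + M) = 0"
    by (simp add: matrix_add_ldistrib matrix_add_rdistrib add_ac)
  moreover have "posdef (M + M)"
    using M unfolding posdef_def transpose_add matrix_vector_mult_add_rdistrib inner_add_right by simp
  ultimately interpret lyapunov_equation X ?S "M + M" by unfold_locales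
  have "posdef ?S" by (intro posdef_solution X) (simp add: transpose_add add.commute)
  hence "0 < x \<bullet> (?S *v x)" using \<open>x \<noteq> 0\<close> unfolding posdef_def by blast
  thus ?thesis
    by (simp add: matrix_vector_mult_add_rdistrib inner_add_right inner_transpose_matrix inner_commute[of "P *v x"]
        del: transpose_matrix_vector)
qed

lemma wnorm_square:
  assumes "\<And>x. x \<noteq> 0 \<Longrightarrow> x \<bullet> (P *v x) > 0"
  shows "(wnorm P x)\<^sup>2 = x \<bullet> (P *v x)"
  using assms[of x] by (cases "x = 0") (simp_all add: wnorm_def)

lemma lyapunov_derivative:
  fixes X P M :: "real^'n^'n"
  assumes "transpose X ** P + P ** X + M = 0"
  shows "(P *v z) \<bullet> (X *v z) + z \<bullet> (P *v (X *v z)) = - (z \<bullet> (M *v z))"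
proof -
  have "z \<bullet> ((transpose X ** P + P ** X + M) *v z) = 0" by (simp add: assms)
  thus ?thesis
    by (simp add: matrix_vector_mult_add_rdistrib inner_add_right inner_transpose_matrix
        inner_commute[of "P *v z"] del: transpose_matrix_vector flip: matrix_vector_mul_assoc)
qed

lemma GDERIV_quadratic_form:
  fixes P :: "real^'n^'n"
  shows "GDERIV (\<lambda>z. z \<bullet> (P *v z)) z :> P *v z + transpose P *v z"
proof -
  have "((\<lambda>z. z \<bullet> (P *v z)) has_derivative (\<lambda>h. z \<bullet> (P *v h) + h \<bullet> (P *v z))) (at z)"
    by (intro has_derivative_inner has_derivative_ident bounded_linear.has_derivative[OF matrix_vector_mul_bounded_linear])
  thus ?thesis
    by (rule has_derivative_eq_rhs[THEN gderiv_def[THEN iffD2]])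
       (simp add: fun_eq_iff inner_add_right inner_commute add.commute flip: dot_lmul_matrix)
qed

lemma positively_invariant_quadratic_sublevel:
  fixes X P M :: "real^'n^'n"
  assumes eq: "transpose X ** P + P ** X + M = 0" and M: "\<And>x. x \<bullet> (M *v x) \<ge> 0"
  shows "positively_invariant (\<lambda>z. X *v z) {z. z \<bullet> (P *v z) \<le> c}"
  unfolding positively_invariant_def
proof (intro allI impI)
  fix z :: "real \<Rightarrow> real^'n" and t :: real
  assume *: "(\<forall>t\<ge>0. (z has_vector_derivative X *v z t) (at t within {0..})) \<and> z 0 \<in> {z. z \<bullet> (P *v z) \<le> c}"
    and t: "t > 0"
  let ?F = "\<lambda>t. z t \<bullet> (P *v z t)"
  have der: "(?F has_real_derivative - (z s \<bullet> (M *v z s))) (at s within {0..})" if "s \<ge> 0" for s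
  proof -
    have "(z has_derivative (\<lambda>h. h *\<^sub>R (X *v z s))) (at s within {0..})"
      using * that by (simp add: has_vector_derivative_def)
    hence "(?F has_derivative (\<lambda>h. z s \<bullet> (P *v (h *\<^sub>R (X *v z s))) + (h *\<^sub>R (X *v z s)) \<bullet> (P *v z s))) (at s within {0..})"
      by (intro has_derivative_inner bounded_linear.has_derivative[OF matrix_vector_mul_bounded_linear])
    moreover have "z s \<bullet> (P *v (h *\<^sub>R (X *v z s))) + (h *\<^sub>R (X *v z s)) \<bullet> (P *v z s)
        = - (z s \<bullet> (M *v z s)) * h" for h
      by (simp add: lyapunov_derivative[OF eq, symmetric] matrix_vector_mult_scaleR inner_commute algebra_simps)
    ultimately show ?thesis unfolding has_field_derivative_def by (simp only:)
  qed
  have "?F t \<le> ?F 0"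
  proof (rule DERIV_nonpos_imp_decreasing_open[of 0 t ?F])
    show "\<exists>y. (?F has_real_derivative y) (at s) \<and> y \<le> 0" if "0 < s" "s < t" for s
      using der[of s] that M[of "z s"] at_within_interior[of s "{0..}"]
      by (intro exI[of _ "- (z s \<bullet> (M *v z s))"]) (auto simp: interior_real_atLeast)
    show "continuous_on {0..t} ?F"
      by (rule continuous_on_subset[OF DERIV_continuous_on[OF der]]) auto
  qed (use t in auto)
  thus "z t \<in> {z. z \<bullet> (P *v z) \<le> c}" using * by simp
qed

theorem proposition3:
  fixes f g :: "real^('n::{finite,linorder}) \<Rightarrow> real^('n::{finite,linorder})"
    and \<phi>x :: "real^('n::{finite,linorder}) \<Rightarrow> real^('n::{finite,linorder})"
    and \<phi>u \<phi>t :: "(real^('n::{finite,linorder})) \<times> (real^1) \<Rightarrow> real"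
    and S :: "(real^('n::{finite,linorder})) set"
    and D Zw V Vt :: "((real^('n::{finite,linorder})) \<times> (real^1)) set"
    and W1 :: "real^(('n::{finite,linorder}) + 1)^'h::finite" and b1 :: "real^'h"
    and W2 :: "real^'h^1" and b2 :: "real^1"
    and ubar eps eps_star :: real
    and A Q M P :: "real^('n::{finite,linorder})^('n::{finite,linorder})" and B :: "real^1^('n::{finite,linorder})" and R :: "real^1^1" and K :: "real^('n::{finite,linorder})^1"
    and ZK Zp :: "(real^('n::{finite,linorder})) set"
  assumes A: "A = chain_A" and B: "B = chain_B"
    and flat: "flat_transformation f g S \<phi>x \<phi>u"
    and domain: "compact D" "D \<subseteq> S \<times> UNIV" "continuous_on D \<phi>u" "Zw \<subseteq> D"
    and net: "\<phi>t = relu_net W1 b1 W2 b2"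
    and error: "(SUP p\<in>Zw. ereal \<bar>\<phi>u p - \<phi>t p\<bar>) \<le> ereal eps"
    and V: "V = constraint_set \<phi>u ubar"
    and Vt: "Vt = constraint_set \<phi>t (ubar - eps)"
    and weights: "Q \<succ> 0" "R \<succ> 0"
    and K: "hurwitz (A + B ** K)"
    and M: "M \<succ> Q + transpose K ** R ** K"
    and P: "transpose (A + B ** K) ** P + P ** (A + B ** K) + M = 0"
    and ZK: "ZK = gain_set Vt K"
    and eps_star: "eps_star = boundary_min P ZK"
    and Zp: "Zp = sublevel_ellipsoid P eps_star"
    and origin: "0 \<in> ZK"
    and boundary: "frontier ZK \<noteq> {}"
    and workspace: "\<forall>z\<in>Zp. (z, K *v z) \<in> Zw"
  shows "(positively_invariant (\<lambda>z. A *v z + B *v (K *v z)) Zp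
            \<and> (\<forall>z\<in>Zp. (z, K *v z) \<in> V))
       \<and> (\<forall>z\<in>Zp. \<exists>grad. GDERIV (\<lambda>z. (wnorm P z)\<^sup>2) z :> grad
            \<and> grad \<bullet> ((A + B ** K) *v z) + stage_cost Q R z (K *v z) \<le> 0)"
proof -
  let ?X = "A + B ** K" and ?N = "Q + transpose K ** R ** K"
  have Q: "posdef Q" and R: "posdef R"
    using weights by (simp_all add: mat_succ_def)
  have MN: "posdef (M - ?N)" using M by (simp add: mat_succ_def)
  have closed_loop: "A *v z + B *v (K *v z) = ?X *v z" for z
    by (simp add: matrix_vector_mult_add_rdistrib matrix_vector_mul_assoc)
  have N: "z \<bullet> (?N *v z) = stage_cost Q R z (K *v z)" for z
    using Q R unfolding posdef_def
    by (simp add: stage_cost_def wnorm_square matrix_vector_mult_add_rdistrib inner_add_right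
        inner_transpose_matrix del: transpose_matrix_vector flip: matrix_vector_mul_assoc)
  have cost_nonneg: "stage_cost Q R z v \<ge> 0" for z v by (simp add: stage_cost_def)
  have decrease: "stage_cost Q R z (K *v z) \<le> z \<bullet> (M *v z)" for z
  proof -
    have "0 \<le> z \<bullet> ((M - ?N) *v z)"
      using MN by (cases "z = 0") (auto simp: posdef_def less_imp_le)
    thus ?thesis
      by (simp only: matrix_vector_mult_diff_rdistrib inner_diff_right N)
  qed
  have "posdef M"
    unfolding posdef_def
  proof (intro conjI allI impI)
    have "transpose ?N = ?N"
      using Q R by (simp add: posdef_def transpose_add matrix_transpose_mul matrix_mul_assoc)
    moreover have "transpose ((M - ?N) + ?N) = transpose (M - ?N) + transpose ?N"
      by (rule transpose_add)
    ultimately show "transpose M = M" using MN by (simp add: posdef_def)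
    show "0 < z \<bullet> (M *v z)" if "z \<noteq> 0" for z
    proof -
      have "0 < z \<bullet> ((M - ?N) *v z)" using MN that by (simp add: posdef_def)
      also have "\<dots> = z \<bullet> (M *v z) - stage_cost Q R z (K *v z)"
        by (simp only: matrix_vector_mult_diff_rdistrib inner_diff_right N)
      finally show ?thesis using cost_nonneg[of z "K *v z"] by linarith
    qed
  qed
  note pos = lyapunov_quadratic_form_pos[OF P this K]
  have norm_P: "(wnorm P z)\<^sup>2 = z \<bullet> (P *v z)" for z by (rule wnorm_square[OF pos])
  have Zp': "Zp = {z. z \<bullet> (P *v z) \<le> eps_star}"
    by (simp add: Zp sublevel_ellipsoid_def norm_P)
  have "z \<bullet> (M *v z) \<ge> 0" for z
    using decrease[of z] cost_nonneg[of z "K *v z"] by linarith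
  hence invariant: "positively_invariant (\<lambda>z. A *v z + B *v (K *v z)) Zp"
    unfolding Zp' closed_loop by (rule positively_invariant_quadratic_sublevel[OF P])
  have "closed ZK" unfolding ZK Vt net by (rule closed_gain_set_relu_net)
  have constraint: "(z, K *v z) \<in> V" if "z \<in> Zp" for z
  proof -
    have "z \<in> ZK"
      using that unfolding Zp' eps_star mem_Collect_eq
      by (rule sublevel_boundary_min_subset[OF _ \<open>closed ZK\<close> origin, rotated]) (rule pos)
    hence "\<bar>\<phi>t (z, K *v z)\<bar> \<le> ubar - eps"
      by (simp add: ZK Vt gain_set_def constraint_set_def)
    moreover have "\<bar>\<phi>u (z, K *v z) - \<phi>t (z, K *v z)\<bar> \<le> eps"
      using error workspace that by (simp add: SUP_le_iff)
    ultimately show ?thesis by (simp add: V constraint_set_def)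
  qed
  have "\<exists>grad. GDERIV (\<lambda>z. (wnorm P z)\<^sup>2) z :> grad
      \<and> grad \<bullet> (?X *v z) + stage_cost Q R z (K *v z) \<le> 0" for z
  proof (intro exI conjI)
    show "GDERIV (\<lambda>z. (wnorm P z)\<^sup>2) z :> P *v z + transpose P *v z"
      unfolding norm_P by (rule GDERIV_quadratic_form)
    have "(P *v z + transpose P *v z) \<bullet> (?X *v z) = - (z \<bullet> (M *v z))"
      unfolding lyapunov_derivative[OF P, symmetric]
      by (simp add: inner_add_left dot_lmul_matrix)
    thus "(P *v z + transpose P *v z) \<bullet> (?X *v z) + stage_cost Q R z (K *v z) \<le> 0"
      using decrease[of z] by linarith
  qed
  with invariant constraint show ?thesis by blast
qed

end
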